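(* Let $X,Y$ be Banach spaces over the same field $\mathbb{K}\in\{\mathbb{R},\mathbb{C}\}$, let $x_0\in X$, $\tau_0\in\mathbb{R}$, $0<r\le\infty$, and put $I=[\tau_0,\tau_0+r)$. Let $\psi\in C(I)$ be a non-decreasing real-valued function. Let $\Psi:B_X(x_0,2r)\to Y$ be a continuous mapping, and let $\Phi:B_X(x_0,r)\to Y$ be Fréchet differentiable at each point of $B_X(x_0,r)$, with $x\mapsto\Phi'(x)$ continuous with respect to the operator norm. Suppose that: (1) the mapping $\Psi$ is a $\psi$-covering; (2) there exists an increasing real-valued function $\varphi\in C^1(I)$ such that $$\|\Phi(x_0)-\Psi(x_0)\|_Y\le\varphi(\tau_0)-\psi(\tau_0),$$ and for each $\tau\in I$ the inequality $\|x-x_0\|_X\le\tau-\tau_0$ implies $\|\Phi'(x)\|\le\varphi'(\tau)$. Assume also that the equation $\psi(\tau)=\varphi(\tau)$ has at least one solution in $I$, and let $\tau_*\in I$ be its smallest solution. Then there exists a point $x_*\in B_X(x_0,r)$ with $\|x_*-x_0\|_X\le\tau_*-\tau_0$ such that $$\Phi(x_* )=\Psi(x_* ).$$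
   Context: For a Banach space $X$, $\hat x\in X$ and $R>0$: $B_X(\hat x,R)=\{x\in X\mid\|x-\hat x\|_X<R\}$ is the open ball and $\overline B_X(\hat x,R)=\{x\in X\mid\|x-\hat x\|_X\le R\}$ is the closed ball (also for $R=0$, where it is $\{\hat x\}$); similarly for $Y$. The value $r=\infty$ is allowed, in which case $I=[\tau_0,\infty)$ and $B_X(x_0,r)=B_X(x_0,2r)=X$. "Increasing" means strictly increasing. $\|\Phi'(x)\|$ is the operator norm of the bounded linear operator $\Phi'(x):X\to Y$. At $\tau_0$ the derivative of a function in $C^1(I)$ is one-sided. Definition ($\psi$-covering). The mapping $\Psi:B_X(x_0,2r)\to Y$ is called a $\psi$-covering if for any $\tau_0\le\tau'<\tau''<\tau_0+r$ and any $x'\in B_X(x_0,r)$ one has $$\overline B_Y\big(\Psi(x'),\psi(\tau'')-\psi(\tau')\big)\subseteq\Psi\Big(\overline B_X(x',\tau''-\tau')\Big).$$ *)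

theory Defs
  imports "HOL-Analysis.Analysis"
begin

(* The ambient Banach space is given by the class banach, which only carries a real vector
   space structure; scale is the multiplication by scalars of a field 'k, extending that of
   the reals.  By the Gelfand-Mazur theorem a real_normed_field is isometrically isomorphic,
   as a real normed algebra, to the reals or to the complex numbers. *)
locale banach_space_over = vector_space scale
  for scale :: "'k::real_normed_field \<Rightarrow> 'x::banach \<Rightarrow> 'x" +
  assumes scale_of_real: "scale (of_real a) x = a *\<^sub>R x"
    and norm_scale: "norm (scale c x) = norm c * norm x"

lemma banach_space_over_real: "banach_space_over ((*\<^sub>R) :: real \<Rightarrow> 'x::banach \<Rightarrow> 'x)"
  by unfold_locales (simp_all add: algebra_simps)

lemma banach_space_over_complex: "banach_space_over ((*) :: complex \<Rightarrow> complex \<Rightarrow> complex)"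
  by unfold_locales (simp_all add: algebra_simps norm_mult scaleR_conv_of_real)

definition halfopen_interval :: "real \<Rightarrow> ereal \<Rightarrow> real set" where
  "halfopen_interval \<tau>0 r = {\<tau>. \<tau>0 \<le> \<tau> \<and> ereal \<tau> < ereal \<tau>0 + r}"

(* Psi is only meant to be defined on eball x0 (2 * r), which contains all the closed balls
   cball x' (t'' - t') below. *)
definition psi_covering ::
    "real \<Rightarrow> ereal \<Rightarrow> 'x::real_normed_vector \<Rightarrow> (real \<Rightarrow> real) \<Rightarrow> ('x \<Rightarrow> 'y::real_normed_vector) \<Rightarrow> bool"
  where
  "psi_covering \<tau>0 r x0 \<psi> \<Psi> \<longleftrightarrow>
     (\<forall>\<tau>' \<tau>'' x'. \<tau>0 \<le> \<tau>' \<and> \<tau>' < \<tau>'' \<and> ereal \<tau>'' < ereal \<tau>0 + r \<and> x' \<in> eball x0 r \<longrightarrow>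
        cball (\<Psi> x') (\<psi> \<tau>'' - \<psi> \<tau>') \<subseteq> \<Psi> ` cball x' (\<tau>'' - \<tau>'))"

end

theory Submission
  imports Defs
begin

text \<open>
  Scalar and vector iterations run in parallel: while \<open>\<phi>\<close> lies above \<open>\<psi>\<close>, the intermediate value
  theorem yields times \<open>\<tau>\<^sub>0 \<le> \<tau>\<^sub>1 \<le> \<dots> \<le> \<tau>\<^sub>*\<close> with \<open>\<psi> \<tau>\<^sub>n\<^sub>+\<^sub>1 = \<phi> \<tau>\<^sub>n\<close>, and the covering property yields
  points with \<open>\<Psi> x\<^sub>n\<^sub>+\<^sub>1 = \<Phi> x\<^sub>n\<close> and \<open>\<parallel>x\<^sub>n\<^sub>+\<^sub>1 - x\<^sub>n\<parallel> \<le> \<tau>\<^sub>n\<^sub>+\<^sub>1 - \<tau>\<^sub>n\<close>.  The mean value inequality preserves the invariant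
  \<open>\<parallel>\<Phi> x\<^sub>n - \<Psi> x\<^sub>n\<parallel> \<le> \<phi> \<tau>\<^sub>n - \<psi> \<tau>\<^sub>n\<close>, which is what makes the next covering step possible.  The times are
  bounded and increasing, so the points form a Cauchy sequence, and its limit is a coincidence point.
\<close>

text \<open>Traverse the segment from \<open>x\<close> to \<open>y\<close> over the time interval
  \<open>{a..b}\<close>. Its speed is at most 1, so at time \<open>t\<close> the moving point is
  within \<open>t - \<tau>0\<close> of \<open>x0\<close>, exactly where the majorant bounds the
  derivative by \<open>\<phi>' t\<close>. The mean value inequality then compares the path with
  \<open>\<phi>\<close>.\<close>

lemma norm_diff_le_majorant:
  fixes \<Phi> :: "'x::real_normed_vector \<Rightarrow> 'y::real_normed_vector"
    and \<phi> \<phi>' :: "real \<Rightarrow> real" and \<Phi>' :: "'x \<Rightarrow> 'x \<Rightarrow>\<^sub>L 'y"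
  assumes x: "norm (x - x0) \<le> a - \<tau>0" and y: "norm (y - x) \<le> b - a"
    and \<Phi>_deriv: "\<And>z. norm (z - x0) \<le> b - \<tau>0 \<Longrightarrow> (\<Phi> has_derivative blinfun_apply (\<Phi>' z)) (at z)"
    and \<phi>_deriv: "\<And>t. t \<in> {a..b} \<Longrightarrow> (\<phi> has_real_derivative \<phi>' t) (at t within {a..b})"
    and majorant: "\<And>t z. \<lbrakk>t \<in> {a..b}; norm (z - x0) \<le> t - \<tau>0\<rbrakk> \<Longrightarrow> norm (\<Phi>' z) \<le> \<phi>' t"
  shows "norm (\<Phi> y - \<Phi> x) \<le> \<phi> b - \<phi> a"
proof (cases "a < b")
  case False
  \<comment> \<open>Here the bound on \<open>norm (y - x)\<close> leaves only \<open>b = a\<close>,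
    hence \<open>y = x\<close>.\<close>
  with y have "b = a" using norm_ge_zero[of "y - x"] by linarith
  with y show ?thesis by simp
next
  case True
  define v where "v = (y - x) /\<^sub>R (b - a)"
  define u where "u t = x + (t - a) *\<^sub>R v" for t
  have norm_v: "norm v \<le> 1"
    using y True unfolding v_def norm_scaleR by (simp add: divide_simps mult.commute)
  have u_bound: "norm (u t - x0) \<le> t - \<tau>0" if "a \<le> t" for t
  proof -
    have "norm (u t - x0) \<le> norm (x - x0) + norm ((t - a) *\<^sub>R v)"
      using norm_triangle_ineq[of "x - x0" "(t - a) *\<^sub>R v"] by (simp add: u_def algebra_simps)
    also have "norm ((t - a) *\<^sub>R v) \<le> t - a"
      using that mult_left_mono[OF norm_v, of "t - a"] by simp
    finally show ?thesis using x by simp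
  qed
  have deriv: "((\<Phi> \<circ> u) has_vector_derivative \<Phi>' (u t) v) (at t)" if "t \<in> {a..b}" for t
  proof -
    have "(u has_vector_derivative v) (at t)"
      unfolding u_def by (auto intro!: derivative_eq_intros)
    moreover have "(\<Phi> has_derivative blinfun_apply (\<Phi>' (u t))) (at (u t))"
      using u_bound[of t] that by (intro \<Phi>_deriv) auto
    ultimately have "((\<Phi> \<circ> u) has_derivative (\<Phi>' (u t) \<circ> (\<lambda>h. h *\<^sub>R v))) (at t)"
      unfolding has_vector_derivative_def by (rule diff_chain_at)
    then show ?thesis
      by (simp add: has_vector_derivative_def o_def blinfun.scaleR_right)
  qed
  have "norm ((\<Phi> \<circ> u) b - (\<Phi> \<circ> u) a) \<le> \<phi> b - \<phi> a"
  proof (rule differentiable_bound_general[OF True])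
    show "continuous_on {a..b} (\<Phi> \<circ> u)"
      using deriv by (meson continuous_at_imp_continuous_on has_vector_derivative_continuous)
    show "continuous_on {a..b} \<phi>"
      using \<phi>_deriv by (rule DERIV_continuous_on)
  next
    fix t assume t: "a < t" "t < b"
    show "((\<Phi> \<circ> u) has_vector_derivative \<Phi>' (u t) v) (at t)"
      using t by (intro deriv) auto
    show "(\<phi> has_vector_derivative \<phi>' t) (at t)"
      using \<phi>_deriv[of t] t
      by (simp add: at_within_Icc_at has_real_derivative_iff_has_vector_derivative)
    have "norm (\<Phi>' (u t) v) \<le> norm (\<Phi>' (u t)) * norm v"
      by (rule norm_blinfun)
    also have "\<dots> \<le> norm (\<Phi>' (u t))"
      using norm_v by (simp add: mult_left_le)
    also have "\<dots> \<le> \<phi>' t"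
      using t u_bound[of t] by (intro majorant) auto
    finally show "norm (\<Phi>' (u t) v) \<le> \<phi>' t" .
  qed
  moreover have "u b = y" "u a = x"
    using True by (simp_all add: u_def v_def)
  ultimately show ?thesis by simp
qed

text \<open>The step bounds telescope to \<open>dist (X n) (X m) \<le> T n - T m\<close> for
  \<open>m \<le> n\<close>, so the Cauchy property passes from \<open>T\<close> to
  \<open>X\<close>.\<close>

lemma convergent_of_dist_le_diff:
  fixes X :: "nat \<Rightarrow> 'a::complete_space" and T :: "nat \<Rightarrow> real"
  assumes "convergent T" and step: "\<And>n. dist (X (Suc n)) (X n) \<le> T (Suc n) - T n"
  shows "convergent X"
proof -
  have bound: "dist (X n) (X m) \<le> T n - T m" if "m \<le> n" for m n
    using that
  proof (induction n rule: dec_induct)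
    case (step n)
    then show ?case
      using assms(2)[of n] dist_triangle[of "X (Suc n)" "X m" "X n"] by linarith
  qed simp
  have "Cauchy X"
  proof (rule metric_CauchyI)
    fix e :: real assume "0 < e"
    then obtain M where M: "\<And>m n. m \<ge> M \<Longrightarrow> n \<ge> M \<Longrightarrow> dist (T m) (T n) < e"
      using convergent_Cauchy[OF assms(1)] unfolding Cauchy_def by meson
    have "dist (X m) (X n) < e" if "m \<ge> M" "n \<ge> M" for m n
      using bound[of m n] bound[of n m] M[OF that] that
      by (cases "m \<le> n") (auto simp: dist_real_def dist_commute)
    then show "\<exists>M. \<forall>m\<ge>M. \<forall>n\<ge>M. dist (X m) (X n) < e" by blast
  qed
  then show ?thesis by (rule Cauchy_convergent)
qed

text \<open>A \<open>LEAST\<close> over the reals is informative only if the minimum is attained. It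
  is, because the coincidence set within \<open>{a..b}\<close> is compact and contains
  \<open>b\<close>. Points of \<open>S\<close> beyond \<open>b\<close> cannot compete, so
  \<open>S\<close> is described only up to \<open>b\<close>.\<close>

lemma Least_coincidence:
  fixes f g :: "real \<Rightarrow> real"
  assumes f: "continuous_on {a..b} f" and g: "continuous_on {a..b} g"
    and "a \<le> b" "f b = g b" and S: "\<And>t. t \<le> b \<Longrightarrow> t \<in> S \<longleftrightarrow> a \<le> t"
  shows "(LEAST t. t \<in> S \<and> f t = g t) \<in> {a..b}"
    and "f (LEAST t. t \<in> S \<and> f t = g t) = g (LEAST t. t \<in> S \<and> f t = g t)"
proof -
  define C where "C = {t \<in> {a..b}. f t = g t}"
  have "closed C"
    unfolding C_def using f g
    by (intro continuous_closed_preimage_constant[where a = 0 and f = "\<lambda>t. f t - g t", simplified]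
      continuous_on_diff) auto
  moreover have "bounded C" "C \<noteq> {}"
    using assms by (auto simp: C_def intro: bounded_subset[of "{a..b}"])
  ultimately obtain m where m: "m \<in> C" "\<And>t. t \<in> C \<Longrightarrow> m \<le> t"
    using compact_attains_inf[of C] by (auto simp: compact_eq_bounded_closed)
  have "(LEAST t. t \<in> S \<and> f t = g t) = m"
  proof (rule Least_equality)
    show "m \<in> S \<and> f m = g m"
      using m(1) S[of m] by (auto simp: C_def)
    fix t assume t: "t \<in> S \<and> f t = g t"
    show "m \<le> t"
    proof (cases "t \<le> b")
      case True
      with t S[of t] show ?thesis by (intro m(2)) (auto simp: C_def)
    next
      case False
      with m(1) show ?thesis by (simp add: C_def)
    qed
  qed
  with m(1) show "(LEAST t. t \<in> S \<and> f t = g t) \<in> {a..b}"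
    "f (LEAST t. t \<in> S \<and> f t = g t) = g (LEAST t. t \<in> S \<and> f t = g t)"
    by (simp_all add: C_def)
qed

text \<open>This admits \<open>s = t\<close>, which \<open>psi_covering\<close> excludes: the radius
  is then 0, so \<open>y = \<Psi> x\<close> and \<open>x\<close> itself serves as \<open>z\<close>.
  The iteration may indeed stall in time.\<close>

lemma psi_coveringE:
  assumes "psi_covering \<tau>0 r x0 \<psi> \<Psi>"
    and "\<tau>0 \<le> s" "s \<le> t" "t \<in> halfopen_interval \<tau>0 r" "x \<in> eball x0 r"
    and "norm (y - \<Psi> x) \<le> \<psi> t - \<psi> s"
  obtains z where "\<Psi> z = y" "norm (z - x) \<le> t - s"
proof (cases "s = t")
  case True
  with assms(6) show ?thesis by (intro that[of x]) auto
next
  case False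
  with assms have "y \<in> \<Psi> ` cball x (t - s)"
    unfolding psi_covering_def halfopen_interval_def
    by (auto simp: dist_norm norm_minus_commute subset_iff)
  then show ?thesis
    by (auto simp: dist_norm norm_minus_commute intro: that)
qed

theorem theorem2:
  fixes scaleX :: "'k::real_normed_field \<Rightarrow> 'x::banach \<Rightarrow> 'x"
    and scaleY :: "'k \<Rightarrow> 'y::banach \<Rightarrow> 'y"
    and x0 :: 'x and \<tau>0 \<tau>s :: real and r :: ereal and I :: "real set"
    and \<psi> \<phi> \<phi>' :: "real \<Rightarrow> real"
    and \<Psi> \<Phi> :: "'x \<Rightarrow> 'y" and \<Phi>' :: "'x \<Rightarrow> 'x \<Rightarrow>\<^sub>L 'y"
  assumes X: "banach_space_over scaleX"
    and Y: "banach_space_over scaleY"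
    and r_pos: "0 < r"
    and I_eq: "I = halfopen_interval \<tau>0 r"
    and psi_cont: "continuous_on I \<psi>"
    and psi_mono: "mono_on I \<psi>"
    and Psi_cont: "continuous_on (eball x0 (2 * r)) \<Psi>"
    and Phi_deriv: "\<And>x. x \<in> eball x0 r \<Longrightarrow> (\<Phi> has_derivative blinfun_apply (\<Phi>' x)) (at x)"
    and Phi_deriv_linear:
      "\<And>x. x \<in> eball x0 r \<Longrightarrow> Vector_Spaces.linear scaleX scaleY (blinfun_apply (\<Phi>' x))"
    and Phi_deriv_cont: "continuous_on (eball x0 r) \<Phi>'"
    and covering: "psi_covering \<tau>0 r x0 \<psi> \<Psi>"
    and phi_increasing: "strict_mono_on I \<phi>"
    and phi_deriv: "\<And>\<tau>. \<tau> \<in> I \<Longrightarrow> (\<phi> has_real_derivative \<phi>' \<tau>) (at \<tau> within I)"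
    and phi_deriv_cont: "continuous_on I \<phi>'"
    and initial: "norm (\<Phi> x0 - \<Psi> x0) \<le> \<phi> \<tau>0 - \<psi> \<tau>0"
    and majorant:
      "\<And>\<tau> x. \<lbrakk>\<tau> \<in> I; norm (x - x0) \<le> \<tau> - \<tau>0\<rbrakk> \<Longrightarrow> norm (\<Phi>' x) \<le> \<phi>' \<tau>"
    and solvable: "\<exists>\<tau>\<in>I. \<psi> \<tau> = \<phi> \<tau>"
    and smallest: "\<tau>s = (LEAST \<tau>. \<tau> \<in> I \<and> \<psi> \<tau> = \<phi> \<tau>)"
  shows "\<exists>xs\<in>eball x0 r. norm (xs - x0) \<le> \<tau>s - \<tau>0 \<and> \<Phi> xs = \<Psi> xs"
proof -
  have in_I: "t \<in> I" if "\<tau>0 \<le> t" "t \<le> s" "s \<in> I" for s t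
  proof -
    have "ereal t \<le> ereal s" using that by simp
    also have "\<dots> < ereal \<tau>0 + r" using that by (simp add: I_eq halfopen_interval_def)
    finally show ?thesis using that by (simp add: I_eq halfopen_interval_def)
  qed
  have phi_cont: "continuous_on I \<phi>"
    using phi_deriv by (rule DERIV_continuous_on)
  obtain t1 where t1: "t1 \<in> I" "\<psi> t1 = \<phi> t1" using solvable by blast
  have t1_ge: "\<tau>0 \<le> t1" using t1(1) by (simp add: I_eq halfopen_interval_def)
  have sub1: "{\<tau>0..t1} \<subseteq> I" using in_I t1(1) by auto
  have mem_I: "t \<in> I \<longleftrightarrow> \<tau>0 \<le> t" if "t \<le> t1" for t
    using in_I[OF _ that t1(1)] by (auto simp: I_eq halfopen_interval_def)
  note least = Least_coincidence[OF continuous_on_subset[OF psi_cont sub1]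
      continuous_on_subset[OF phi_cont sub1] t1_ge t1(2) mem_I, folded smallest]
  have \<tau>s: "\<tau>0 \<le> \<tau>s" "\<tau>s \<in> I" "\<psi> \<tau>s = \<phi> \<tau>s"
    using least mem_I[of \<tau>s] by auto
  have sub: "{\<tau>0..\<tau>s} \<subseteq> I" using in_I \<tau>s(2) by auto
  \<comment> \<open>As \<open>I\<close> is open on the right, \<open>\<tau>s - \<tau>0 < r\<close>,
    also for infinite \<open>r\<close>. Hence the iterates and their limit stay in the open
    ball.\<close>
  have in_ball: "x \<in> eball x0 r" if "norm (x - x0) \<le> t - \<tau>0" "t \<le> \<tau>s" for x t
  proof -
    have "ereal (norm (x - x0)) \<le> ereal \<tau>s - ereal \<tau>0" using that by simp
    also have "\<dots> < r"
      using \<tau>s(2) by (cases r) (auto simp: I_eq halfopen_interval_def)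
    finally show ?thesis by (simp add: eball_def dist_norm norm_minus_commute)
  qed

  define inv where "inv = (\<lambda>(t, x). t \<in> {\<tau>0..\<tau>s} \<and> norm (x - x0) \<le> t - \<tau>0
    \<and> norm (\<Phi> x - \<Psi> x) \<le> \<phi> t - \<psi> t)"
  define step where "step = (\<lambda>(t, x) (t', x'). t \<le> t' \<and> \<psi> t' = \<phi> t
    \<and> \<Psi> x' = \<Phi> x \<and> norm (x' - x) \<le> t' - t)"
  have ex_step: "\<exists>q. inv q \<and> step p q" if p: "inv p" for p
  proof -
    obtain t x where [simp]: "p = (t, x)" by fastforce
    have t: "\<tau>0 \<le> t" "t \<le> \<tau>s" and x: "norm (x - x0) \<le> t - \<tau>0"
      and defect: "norm (\<Phi> x - \<Psi> x) \<le> \<phi> t - \<psi> t"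
      using p by (auto simp: inv_def)
    have "t \<in> I" using sub t by auto
    have "\<psi> t \<le> \<phi> t" using defect norm_ge_zero[of "\<Phi> x - \<Psi> x"] by linarith
    \<comment> \<open>Together with \<open>\<psi> t \<le> \<phi> t\<close> this puts the value
      \<open>\<phi> t\<close> between \<open>\<psi> t\<close> and \<open>\<psi> \<tau>s\<close>, so
      \<open>\<psi>\<close> attains it no later than \<open>\<tau>s\<close>.\<close>
    moreover have "\<phi> t \<le> \<psi> \<tau>s"
      using strict_mono_on_leD[OF phi_increasing \<open>t \<in> I\<close> \<tau>s(2) t(2)] \<tau>s(3) by simp
    moreover have "continuous_on {t..\<tau>s} \<psi>"
      using t by (intro continuous_on_subset[OF psi_cont] order_trans[OF _ sub]) auto
    ultimately obtain t' where t': "t \<le> t'" "t' \<le> \<tau>s" "\<psi> t' = \<phi> t"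
      using IVT'[of \<psi> t "\<phi> t" \<tau>s] t by blast
    have "t' \<in> halfopen_interval \<tau>0 r" using sub t t' by (auto simp: I_eq)
    \<comment> \<open>The covering radius \<open>\<psi> t' - \<psi> t\<close> equals
      \<open>\<phi> t - \<psi> t\<close>, which is the bound on the defect at \<open>x\<close>; so
      \<open>\<Phi> x\<close> lies in the covered ball.\<close>
    then obtain x' where x': "\<Psi> x' = \<Phi> x" "norm (x' - x) \<le> t' - t"
      using psi_coveringE[OF covering t(1) t'(1) _ in_ball[OF x t(2)], of "\<Phi> x"] defect t'(3)
      by metis
    have sub': "{t..t'} \<subseteq> I" using sub t t' by auto
    \<comment> \<open>Since \<open>\<Psi> x' = \<Phi> x\<close> and
      \<open>\<psi> t' = \<phi> t\<close>, this is the defect bound required by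
      \<open>inv (t', x')\<close>.\<close>
    have "norm (\<Phi> x' - \<Phi> x) \<le> \<phi> t' - \<phi> t"
    proof (rule norm_diff_le_majorant[OF x x'(2)])
      show "(\<Phi> has_derivative blinfun_apply (\<Phi>' z)) (at z)" if "norm (z - x0) \<le> t' - \<tau>0" for z
        using in_ball[OF that t'(2)] by (rule Phi_deriv)
      show "(\<phi> has_real_derivative \<phi>' s) (at s within {t..t'})" if "s \<in> {t..t'}" for s
        using that sub' by (meson phi_deriv DERIV_subset subsetD)
      show "norm (\<Phi>' z) \<le> \<phi>' s" if "s \<in> {t..t'}" "norm (z - x0) \<le> s - \<tau>0" for s z
        using that sub' by (intro majorant) auto
    qed
    moreover have "norm (x' - x0) \<le> t' - \<tau>0"
      using norm_triangle_ineq[of "x' - x" "x - x0"] x x'(2) by simp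
    ultimately have "inv (t', x') \<and> step p (t', x')"
      using t t' x' by (simp add: inv_def step_def)
    then show ?thesis by blast
  qed
  have "inv (\<tau>0, x0)" using \<tau>s initial by (simp add: inv_def)
  then obtain p where p: "\<And>n. inv (p n)" "\<And>n. step (p n) (p (Suc n))"
    using dependent_nat_choice[of "\<lambda>_. inv" "\<lambda>_. step"] ex_step by metis
  define T where "T n = fst (p n)" for n
  define X where "X n = snd (p n)" for n
  have T: "\<tau>0 \<le> T n" "T n \<le> \<tau>s" and X_ball: "norm (X n - x0) \<le> T n - \<tau>0" for n
    using p(1)[of n] by (auto simp: inv_def T_def X_def split_beta)
  have T_step: "T n \<le> T (Suc n)"
    and X_step: "\<Psi> (X (Suc n)) = \<Phi> (X n)" "norm (X (Suc n) - X n) \<le> T (Suc n) - T n" for n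
    using p(2)[of n] by (auto simp: step_def T_def X_def split_beta)
  have "convergent T"
    using incseq_convergent[of T \<tau>s, OF incseq_SucI[of T, OF T_step]] T(2)
    unfolding convergent_def by blast
  moreover from this have "convergent X"
    using X_step(2) by (rule convergent_of_dist_le_diff[of T X, unfolded dist_norm])
  ultimately obtain xs ts where "T \<longlonglongrightarrow> ts" and X_lim: "X \<longlonglongrightarrow> xs"
    by (auto simp: convergent_def)
  \<comment> \<open>A radius independent of \<open>n\<close> gives a closed condition that survives
    the limit.\<close>
  have "norm (X n - x0) \<le> \<tau>s - \<tau>0" for n
    using X_ball[of n] T(2)[of n] by linarith
  then have xs: "norm (xs - x0) \<le> \<tau>s - \<tau>0"
    using X_lim by (intro LIMSEQ_le_const2[OF tendsto_norm[OF tendsto_diff[OF X_lim tendsto_const]]]) auto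
  then have xs_ball: "xs \<in> eball x0 r" by (rule in_ball) simp
  have "(\<lambda>n. \<Phi> (X n)) \<longlonglongrightarrow> \<Phi> xs"
    using isCont_tendsto_compose[OF has_derivative_continuous[OF Phi_deriv[OF xs_ball]] X_lim] .
  \<comment> \<open>By \<open>X_step\<close> this is the same sequence as
    \<open>\<Phi> (X n)\<close>, so the two limits agree.\<close>
  moreover have "(\<lambda>n. \<Psi> (X (Suc n))) \<longlonglongrightarrow> \<Psi> xs"
  proof (rule isCont_tendsto_compose[OF _ LIMSEQ_Suc[OF X_lim]])
    have "r \<le> 2 * r" using r_pos by (cases r) auto
    then have "xs \<in> eball x0 (2 * r)" using xs_ball by (auto simp: eball_def)
    then show "isCont \<Psi> xs"
      using Psi_cont by (simp add: continuous_on_eq_continuous_at)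
  qed
  ultimately have "\<Phi> xs = \<Psi> xs"
    using LIMSEQ_unique X_step(1) by auto
  with xs xs_ball show ?thesis by blast
qed

end
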